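(* In the setting of the context, let $f$ be a decreasing continuous bijection from $(1,+\infty)$ onto $(0,+\infty)$, with $\lim_{x\to+\infty}f(x)=0$ and $\lim_{x\to1}f(x)=+\infty$ (and set $f(1)=+\infty$). Let $W:\mathbb{R}^d\to[1,+\infty)$ be a function for which there exist $\alpha>0$, $\beta>0$, $n_0\in\mathbb{N}$ such that $$\forall n\ge n_0,\quad\frac{\mathbb{E}\bigl[W(X_{n+1})\,|\,\mathcal{F}_n\bigr]-W(X_n)}{\tilde\gamma_{n+1}}\le-\alpha W(X_n)+\beta .$$ If $\chi_n\ge(f\circ W)(X_n)$ for all $n\ge0$, and if $(\gamma_n)_{n\ge0}$ satisfies $$\sum_{n\ge1}\frac{\gamma_n}{f^{-1}(\gamma_n)}<+\infty,$$ where $f^{-1}$ is the inverse of $f$, then there is an almost surely finite random variable $n_1$ such that $\tilde\gamma_n=\gamma_n$ for every $n\ge n_1$.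
   Context: **Noise.** $(U_n)_{n\ge1}$ are i.i.d. $\mathbb{R}^m$-valued random variables with $\mathrm{var}(U_1)=\mathrm{Id}_m$ and, for some $\kappa>0$, $\mathbb{E}[\exp\langle\theta,U_1\rangle]\le\exp(\kappa|\theta|^2/2)$ for all $\theta\in\mathbb{R}^m$. $\mathcal{F}_n=\sigma(U_1,\dots,U_n)$, $\mathcal{F}_0$ trivial. **Scheme.** $b:\mathbb{R}^d\to\mathbb{R}^d$ and $\sigma:\mathbb{R}^d\to\mathbb{R}^{d\times m}$ are locally Lipschitz. $(\gamma_n)_{n\ge0}$ is a deterministic nonincreasing sequence of positive numbers with $\lim_n\gamma_n=0$ and $\sum_n\gamma_n=+\infty$; $(\chi_n)_{n\ge0}$ is an $(\mathcal{F}_n)$-adapted sequence of positive random variables; $\tilde\gamma_0=\gamma_0$ and $\tilde\gamma_n=\gamma_n\wedge\chi_{n-1}$ for $n\ge1$. From a deterministic $X_0=x_0\in\mathbb{R}^d$, $$X_{n+1}=X_n+\tilde\gamma_{n+1}b(X_n)+\sqrt{\tilde\gamma_{n+1}}\,\sigma(X_n)U_{n+1},\quad n\ge0.$$ **Standing assumption.** There is a $C^2$ function $V:\mathbb{R}^d\to[1,+\infty)$ with $V(x)\to+\infty$ as $|x|\to+\infty$ such that: for some $\alpha_V,\beta_V>0$, $\langle\nabla V,b\rangle\le-\alpha_VV+\beta_V$; for some $C_{V,\sigma}>0$ and $a\in(0,1]$, $\mathrm{Tr}(\sigma^*(\nabla V)^{\otimes2}\sigma)\le C_{V,\sigma}V^{2-a}$;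 and for some $C>0$, $\sup_x\mathrm{Tr}(\sigma^*D^2V\sigma)(x)\le C\sup_x\mathrm{Tr}(\sigma^*\sigma)(x)$. Functions $W$ are Borel measurable; (in)equalities between random variables hold almost surely. *)

theory Defs
  imports "HOL-Probability.Probability"
begin

definition covariance_matrix :: "'w measure \<Rightarrow> ('w \<Rightarrow> real ^ 'm) \<Rightarrow> real ^ 'm ^ 'm" where
  "covariance_matrix M Y = (\<chi> i j. \<integral>\<omega>. (Y \<omega> $ i - (\<integral>\<xi>. Y \<xi> $ i \<partial>M)) * (Y \<omega> $ j - (\<integral>\<xi>. Y \<xi> $ j \<partial>M)) \<partial>M)"

text \<open>
  Only the variables \<^term>\<open>U n\<close> with \<^term>\<open>n \<ge> (1::nat)\<close> are part of the noise; \<^term>\<open>U 0\<close> is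
  never used. The Laplace transform is a Lebesgue integral with values in \<^typ>\<open>ennreal\<close>, so that
  the bound includes its finiteness.
\<close>

definition subgaussian_noise :: "'w measure \<Rightarrow> (nat \<Rightarrow> 'w \<Rightarrow> real ^ 'm) \<Rightarrow> bool" where
  "subgaussian_noise M U \<longleftrightarrow>
     prob_space.indep_vars M (\<lambda>_. borel) U {1..} \<and>
     (\<forall>n\<ge>1. distr M borel (U n) = distr M borel (U 1)) \<and>
     integrable M (\<lambda>\<omega>. (norm (U 1 \<omega>))\<^sup>2) \<and>
     covariance_matrix M (U 1) = mat 1 \<and>
     (\<exists>\<kappa>>0. \<forall>\<theta>. (\<integral>\<^sup>+\<omega>. ennreal (exp (\<theta> \<bullet> U 1 \<omega>)) \<partial>M) \<le> ennreal (exp (\<kappa> * (norm \<theta>)\<^sup>2 / 2)))"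

definition noise_filtration :: "'w measure \<Rightarrow> (nat \<Rightarrow> 'w \<Rightarrow> real ^ 'm) \<Rightarrow> nat \<Rightarrow> 'w measure" where
  "noise_filtration M U n =
     sigma (space M) (\<Union>k\<in>{1..n}. {U k -` A \<inter> space M | A. A \<in> sets borel})"

text \<open>
  The thresholds \<open>chi n\<close> take values in \<^typ>\<open>ennreal\<close>: the lower bound \<open>f (W (X n)) \<le> chi n\<close>
  equals \<open>\<infinity>\<close> where \<open>W (X n) = 1\<close>. The minimum with a real step is always finite.
\<close>

fun adaptive_step :: "(nat \<Rightarrow> real) \<Rightarrow> (nat \<Rightarrow> 'w \<Rightarrow> ennreal) \<Rightarrow> nat \<Rightarrow> 'w \<Rightarrow> real" where
  "adaptive_step \<gamma> chi 0 \<omega> = \<gamma> 0"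
| "adaptive_step \<gamma> chi (Suc n) \<omega> = enn2real (min (ennreal (\<gamma> (Suc n))) (chi n \<omega>))"

fun euler_scheme ::
    "(real ^ 'd \<Rightarrow> real ^ 'd) \<Rightarrow> (real ^ 'd \<Rightarrow> real ^ 'm ^ 'd) \<Rightarrow> (nat \<Rightarrow> 'w \<Rightarrow> real) \<Rightarrow>
     (nat \<Rightarrow> 'w \<Rightarrow> real ^ 'm) \<Rightarrow> real ^ 'd \<Rightarrow> nat \<Rightarrow> 'w \<Rightarrow> real ^ 'd" where
  "euler_scheme b \<sigma> h U x\<^sub>0 0 \<omega> = x\<^sub>0"
| "euler_scheme b \<sigma> h U x\<^sub>0 (Suc n) \<omega> =
     euler_scheme b \<sigma> h U x\<^sub>0 n \<omega>
     + h (Suc n) \<omega> *\<^sub>R b (euler_scheme b \<sigma> h U x\<^sub>0 n \<omega>)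
     + sqrt (h (Suc n) \<omega>) *\<^sub>R (\<sigma> (euler_scheme b \<sigma> h U x\<^sub>0 n \<omega>) *v U (Suc n) \<omega>)"

definition tensor_square :: "real ^ 'd \<Rightarrow> real ^ 'd ^ 'd" where
  "tensor_square v = (\<chi> i j. v $ i * v $ j)"

definition C2_with :: "(real ^ 'd \<Rightarrow> real) \<Rightarrow> (real ^ 'd \<Rightarrow> real ^ 'd) \<Rightarrow> (real ^ 'd \<Rightarrow> real ^ 'd ^ 'd) \<Rightarrow> bool" where
  "C2_with V DV D2V \<longleftrightarrow>
     (\<forall>x. GDERIV V x :> DV x) \<and>
     (\<forall>x. (DV has_derivative (\<lambda>h. D2V x *v h)) (at x)) \<and>
     continuous_on UNIV D2V"

text \<open>
  The last clause compares suprema in \<^typ>\<open>ereal\<close>, as both may be infinite.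
\<close>

definition lyapunov ::
    "(real ^ 'd \<Rightarrow> real ^ 'd) \<Rightarrow> (real ^ 'd \<Rightarrow> real ^ 'm ^ 'd) \<Rightarrow> (real ^ 'd \<Rightarrow> real) \<Rightarrow> bool" where
  "lyapunov b \<sigma> V \<longleftrightarrow>
     (\<forall>x. 1 \<le> V x) \<and> filterlim V at_top at_infinity \<and>
     (\<exists>DV D2V. C2_with V DV D2V \<and>
       (\<exists>\<alpha>>0. \<exists>\<beta>>0. \<forall>x. DV x \<bullet> b x \<le> - \<alpha> * V x + \<beta>) \<and>
       (\<exists>C>0. \<exists>a. 0 < a \<and> a \<le> 1 \<and>
         (\<forall>x. trace (transpose (\<sigma> x) ** tensor_square (DV x) ** \<sigma> x) \<le> C * V x powr (2 - a))) \<and>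
       (\<exists>C>0. (SUP x. ereal (trace (transpose (\<sigma> x) ** D2V x ** \<sigma> x)))
                \<le> ereal C * (SUP x. ereal (trace (transpose (\<sigma> x) ** \<sigma> x)))))"

definition infinite_at_one :: "(real \<Rightarrow> real) \<Rightarrow> real \<Rightarrow> ennreal" where
  "infinite_at_one f x = (if x = 1 then \<infinity> else ennreal (f x))"

text \<open>
  The relative conditional increment \<open>(E[W (X (n+1)) | F n] - W (X n)) / h (n+1)\<close> for nonnegative
  \<^term>\<open>W\<close>. No integrability of \<^term>\<open>W \<circ> X (Suc n)\<close> is presupposed: the conditional expectation is
  the \<open>[0,\<infinity>]\<close>-valued one, since the real-valued \<^const>\<open>real_cond_exp\<close> would turn \<open>\<infinity>\<close> into \<open>0\<close>.
\<close>

definition cond_increment_rate ::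
    "'w measure \<Rightarrow> (nat \<Rightarrow> 'w measure) \<Rightarrow> (nat \<Rightarrow> 'w \<Rightarrow> real) \<Rightarrow> (nat \<Rightarrow> 'w \<Rightarrow> 'x) \<Rightarrow>
     ('x \<Rightarrow> real) \<Rightarrow> nat \<Rightarrow> 'w \<Rightarrow> ereal" where
  "cond_increment_rate M F h X W n \<omega> =
     (enn2ereal (nn_cond_exp M (F n) (\<lambda>\<xi>. ennreal (W (X (Suc n) \<xi>))) \<omega>) - ereal (W (X n \<omega>)))
       / ereal (h (Suc n) \<omega>)"

end

theory Submission
  imports Defs
begin

text \<open>
  The step \<open>h (n+1)\<close> differs from \<open>\<gamma> (n+1)\<close> only if \<open>W (X n)\<close> exceeds the barrier
  \<open>c n = f\<inverse> (\<gamma> (n+1))\<close>, and \<open>c\<close> increases to infinity. Dropping the term \<open>-\<alpha> W\<close> of the drift leaves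
  \<open>E[W (X (n+1)) | F n] \<le> W (X n) + \<beta> \<gamma> (n+1)\<close>. Hence, on an event \<open>A\<close> where \<open>W (X n\<^sub>0)\<close> is bounded
  (\<open>W (X n\<^sub>0)\<close> need not be integrable), the probability of crossing the barrier after time \<open>N\<close> is at
  most \<open>E[1_A W (X N)] / c N + \<beta> \<Sum>n\<ge>N. \<gamma> (n+1) / c n\<close>. The sum is the tail of a convergent series, and the
  first term, at most \<open>(K + \<beta> \<Sum>k\<le>N. \<gamma> k) / c N\<close> with \<open>K\<close> the bound on \<open>A\<close>, vanishes by Kronecker's lemma.
\<close>

section \<open>Kronecker's lemma for nonnegative terms\<close>

lemma kronecker_nonneg:
  fixes g c :: "nat \<Rightarrow> real"
  assumes g: "\<And>n. 0 \<le> g n" and c: "incseq c" "\<And>n. 0 < c n" "filterlim c at_top sequentially"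
    and sm: "summable (\<lambda>n. g n / c n)"
  shows "(\<lambda>N. (\<Sum>k<N. g k) / c N) \<longlonglongrightarrow> 0"
proof -
  \<comment> \<open>The quotient is written as a series over all \<open>k\<close>, cut off at
    \<open>N\<close>. For fixed \<open>k\<close> the term \<open>g k / c N\<close> tends to 0
    because \<open>c\<close> diverges, and for \<open>k < N\<close> it is dominated by the summable
    \<open>g k / c k\<close> because \<open>c\<close> increases. Tannery's theorem exchanges limit
    and sum.\<close>
  have lim: "(\<lambda>N. \<Sum>k. if k < N then g k / c N else 0) \<longlonglongrightarrow> (\<Sum>k. 0)"
  proof (rule tannerys_theorem[where M = "\<lambda>k. g k / c k", THEN conjunct2, THEN conjunct2])
    show "(\<lambda>N. if k < N then g k / c N else 0) \<longlonglongrightarrow> 0" for k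
    proof (rule Lim_transform_eventually)
      show "(\<lambda>N. g k / c N) \<longlonglongrightarrow> 0"
        by (rule real_tendsto_divide_at_top[OF tendsto_const c(3)])
      show "\<forall>\<^sub>F N in sequentially. g k / c N = (if k < N then g k / c N else 0)"
        using eventually_gt_at_top[of k] by eventually_elim simp
    qed
    have "norm (if k < N then g k / c N else 0) \<le> g k / c k" for k N
    proof (cases "k < N")
      case True
      then have "c k \<le> c N" using c(1) by (simp add: incseqD)
      then show ?thesis using True g[of k] c(2)[of k] c(2)[of N]
        by (simp add: frac_le)
    qed (use g[of k] c(2)[of k] in auto)
    then show "\<forall>\<^sub>F (k, N) in at_top \<times>\<^sub>F sequentially.
        norm (if k < N then g k / c N else 0) \<le> g k / c k"
      by (intro always_eventually) auto
    show "summable (\<lambda>k. g k / c k)" by (rule sm)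
  qed auto
  have "(\<Sum>k. if k < N then g k / c N else 0) = (\<Sum>k<N. g k) / c N" for N
    by (subst suminf_finite[of "{..<N}"]) (auto simp: sum_divide_distrib)
  with lim show ?thesis by simp
qed

section \<open>Crossing of an increasing barrier by a process with bounded upward drift\<close>

context prob_space
begin

text \<open>Over an event of the conditioning sigma-algebra, \<open>Y\<close> and its conditional
  expectation have the same integral, so a conditional bound becomes a bound between integrals.
  Values in [0,\<infinity>] allow this before any moment is known to be finite.\<close>

lemma nn_cond_exp_drift_integral:
  assumes sub: "subalgebra M \<F>" and G: "G \<in> sets \<F>"
    and Y: "Y \<in> borel_measurable M" "Z \<in> borel_measurable M"
    and drift: "AE \<omega> in M. nn_cond_exp M \<F> Y \<omega> \<le> Z \<omega>"
  shows "(\<integral>\<^sup>+\<omega>. indicator G \<omega> * Y \<omega> \<partial>M) \<le> (\<integral>\<^sup>+\<omega>. indicator G \<omega> * Z \<omega> \<partial>M)"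
proof -
  interpret sigma_finite_subalgebra M \<F>
    by (rule finite_measure_subalgebra_is_sigma_finite)
      (use sub in \<open>unfold_locales, auto\<close>)
  have "(\<integral>\<^sup>+\<omega>. indicator G \<omega> * Y \<omega> \<partial>M) = (\<integral>\<^sup>+\<omega>. indicator G \<omega> * nn_cond_exp M \<F> Y \<omega> \<partial>M)"
    using G Y by (intro nn_cond_exp_intg[symmetric]) auto
  also have "\<dots> \<le> (\<integral>\<^sup>+\<omega>. indicator G \<omega> * Z \<omega> \<partial>M)"
    using drift by (intro nn_integral_mono_AE) (auto split: split_indicator elim!: eventually_mono)
  finally show ?thesis .
qed

text \<open>
  With \<open>Q L\<close> the part of \<open>A\<close> where the barrier \<open>c\<close> has been crossed before time \<open>L\<close>, the quantity
  \<open>\<Phi> L = E[1_{Q L} + 1_{A - Q L} Y L / c L]\<close> grows by at most \<open>g L / c L\<close> per step.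
\<close>

lemma barrier_maximal_inequality:
  fixes Y :: "nat \<Rightarrow> 'a \<Rightarrow> ennreal" and g c :: "nat \<Rightarrow> real"
  assumes sub: "\<And>n. subalgebra M (\<F> n)" and mono: "\<And>m n. m \<le> n \<Longrightarrow> sets (\<F> m) \<subseteq> sets (\<F> n)"
    and Y: "\<And>n. Y n \<in> borel_measurable (\<F> n)"
    and drift: "\<And>n. N \<le> n \<Longrightarrow> AE \<omega> in M. nn_cond_exp M (\<F> n) (Y (Suc n)) \<omega> \<le> Y n \<omega> + ennreal (g n)"
    and g: "\<And>n. 0 \<le> g n" and c: "incseq c" "\<And>n. 0 < c n"
    and A: "A \<in> sets (\<F> N)" and "N \<le> L"
  shows "emeasure M {\<omega> \<in> A. \<exists>n\<in>{N..<L}. ennreal (c n) < Y n \<omega>}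
    \<le> (\<integral>\<^sup>+\<omega>. indicator A \<omega> * Y N \<omega> \<partial>M) / ennreal (c N) + (\<Sum>n=N..<L. ennreal (g n / c n))"
proof -
  define Q where "Q L = {\<omega> \<in> A. \<exists>n\<in>{N..<L}. ennreal (c n) < Y n \<omega>}" for L
  define \<Phi> where "\<Phi> L = (\<integral>\<^sup>+\<omega>. indicator (Q L) \<omega> + indicator (A - Q L) \<omega> * (Y L \<omega> / ennreal (c L)) \<partial>M)" for L
  have spc: "space (\<F> n) = space M" for n using sub[of n] by (simp add: subalgebra_def)
  have setsM: "G \<in> sets M" if "G \<in> sets (\<F> n)" for G n
    using sub[of n] that by (auto simp: subalgebra_def)
  have YM[measurable]: "Y n \<in> borel_measurable M" for n
    using measurable_from_subalg[OF sub Y] .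
  have Yle: "Y m \<in> borel_measurable (\<F> n)" if "m \<le> n" for m n
    using Y[of m] mono[OF that] by (auto simp: measurable_def spc)
  \<comment> \<open>\<open>Q (Suc L)\<close> involves the process only up to time \<open>L\<close>,
    so it is decided at time \<open>L\<close>. Hence the conditional bound for
    \<open>Y (Suc L)\<close> can be integrated over \<open>A - Q (Suc L)\<close>.\<close>
  have QF: "Q (Suc L) \<in> sets (\<F> L)" if L: "N \<le> L" for L
  proof -
    have "Q (Suc L) = A \<inter> (\<Union>n\<in>{N..<Suc L}. {\<omega> \<in> space (\<F> L). ennreal (c n) < Y n \<omega>})"
      using sets.sets_into_space[OF A] by (auto simp: Q_def spc)
    also have "\<dots> \<in> sets (\<F> L)"
    proof (intro sets.Int sets.finite_UN)
      show "A \<in> sets (\<F> L)" using A mono[OF L] by auto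
      fix n assume "n \<in> {N..<Suc L}"
      then have [measurable]: "Y n \<in> borel_measurable (\<F> L)" using Yle by auto
      show "{\<omega> \<in> space (\<F> L). ennreal (c n) < Y n \<omega>} \<in> sets (\<F> L)" by measurable
    qed auto
    finally show ?thesis .
  qed
  have AM[measurable]: "A \<in> sets M" using A setsM by auto
  have QM[measurable]: "Q L \<in> sets M" for L
  proof -
    consider "L \<le> N" | L' where "L = Suc L'" "N \<le> L'" by (cases L) (use not_less_eq_eq in auto)
    then show ?thesis
    proof cases
      case 1
      then have "Q L = {}" by (auto simp: Q_def)
      then show ?thesis by simp
    next
      case 2
      then show ?thesis using setsM[OF QF] by simp
    qed
  qed
  have Qsub: "Q L \<subseteq> A" for L by (auto simp: Q_def)
  have step: "\<Phi> (Suc L) \<le> \<Phi> L + ennreal (g L / c L)" if L: "N \<le> L" for L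
  proof -
    let ?G = "A - Q (Suc L)"
    have "?G \<in> sets (\<F> L)" using A mono[OF L] QF[OF L] by auto
    have QSuc: "Q (Suc L) = Q L \<union> {\<omega> \<in> A. ennreal (c L) < Y L \<omega>}"
      using L by (auto simp: Q_def atLeastLessThanSuc)
    have "\<Phi> (Suc L) = emeasure M (Q (Suc L)) + (\<integral>\<^sup>+\<omega>. indicator ?G \<omega> * Y (Suc L) \<omega> / ennreal (c (Suc L)) \<partial>M)"
      unfolding \<Phi>_def by (subst nn_integral_add) (auto simp: ennreal_times_divide)
    also have "(\<integral>\<^sup>+\<omega>. indicator ?G \<omega> * Y (Suc L) \<omega> / ennreal (c (Suc L)) \<partial>M)
        = (\<integral>\<^sup>+\<omega>. indicator ?G \<omega> * Y (Suc L) \<omega> \<partial>M) / ennreal (c (Suc L))"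
      by (intro nn_integral_divide) auto
    \<comment> \<open>The drift replaces \<open>Y (Suc L)\<close> by \<open>Y L + g L\<close>; then
      \<open>c (Suc L)\<close> is lowered to \<open>c L\<close>, which can only enlarge the
      quotient.\<close>
    also have "\<dots> \<le> (\<integral>\<^sup>+\<omega>. indicator ?G \<omega> * (Y L \<omega> + ennreal (g L)) \<partial>M) / ennreal (c L)"
    proof (rule order_trans[OF divide_right_mono_ennreal])
      show "(\<integral>\<^sup>+\<omega>. indicator ?G \<omega> * Y (Suc L) \<omega> \<partial>M) \<le> (\<integral>\<^sup>+\<omega>. indicator ?G \<omega> * (Y L \<omega> + ennreal (g L)) \<partial>M)"
        using nn_cond_exp_drift_integral[OF sub \<open>?G \<in> sets (\<F> L)\<close> _ _ drift[OF L]] by auto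
      show "(\<integral>\<^sup>+\<omega>. indicator ?G \<omega> * (Y L \<omega> + ennreal (g L)) \<partial>M) / ennreal (c (Suc L))
          \<le> (\<integral>\<^sup>+\<omega>. indicator ?G \<omega> * (Y L \<omega> + ennreal (g L)) \<partial>M) / ennreal (c L)"
        using incseq_SucD[OF c(1), of L] c(2)[of L] c(2)[of "Suc L"]
        by (auto simp: divide_ennreal_def inverse_ennreal intro!: mult_left_mono ennreal_leI le_imp_inverse_le)
    qed
    also have "\<dots> = (\<integral>\<^sup>+\<omega>. indicator ?G \<omega> * (Y L \<omega> + ennreal (g L)) / ennreal (c L) \<partial>M)"
      by (intro nn_integral_divide[symmetric]) auto
    also have "emeasure M (Q (Suc L)) + \<dots>
        = (\<integral>\<^sup>+\<omega>. indicator (Q (Suc L)) \<omega> + indicator ?G \<omega> * (Y L \<omega> + ennreal (g L)) / ennreal (c L) \<partial>M)"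
      by (subst nn_integral_add) auto
    also have "\<dots> \<le> (\<integral>\<^sup>+\<omega>. (indicator (Q L) \<omega> + indicator (A - Q L) \<omega> * (Y L \<omega> / ennreal (c L))) + ennreal (g L / c L) \<partial>M)"
    proof (intro nn_integral_mono)
      fix \<omega>
      have cg: "ennreal (g L) / ennreal (c L) = ennreal (g L / c L)"
        using g c(2) by (simp add: divide_ennreal)
      \<comment> \<open>The decisive case is the third, a first crossing at time \<open>L\<close>:
        the left side becomes 1, and this is paid for by \<open>Y L / c L\<close>, which is at least
        1 there. In the fourth case, with no crossing up to time \<open>L\<close>, the two sides
        agree.\<close>
      consider "\<omega> \<notin> A" | "\<omega> \<in> Q L" | "\<omega> \<in> A - Q L" "ennreal (c L) < Y L \<omega>" | "\<omega> \<in> A - Q (Suc L)"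
        using QSuc by blast
      then show "indicator (Q (Suc L)) \<omega> + indicator ?G \<omega> * (Y L \<omega> + ennreal (g L)) / ennreal (c L)
        \<le> (indicator (Q L) \<omega> + indicator (A - Q L) \<omega> * (Y L \<omega> / ennreal (c L))) + ennreal (g L / c L)"
      proof cases
        case 1
        then show ?thesis using Qsub by (auto simp: indicator_def)
      next
        case 2
        then have "\<omega> \<in> Q (Suc L)" by (simp add: QSuc)
        with 2 show ?thesis by (simp add: indicator_def)
      next
        case 3
        then have "\<omega> \<in> Q (Suc L)" by (simp add: QSuc)
        moreover have "1 \<le> Y L \<omega> / ennreal (c L)"
        proof -
          have "1 = ennreal (c L) / ennreal (c L)" using c(2)[of L] by (simp add: ennreal_divide_self)
          also have "\<dots> \<le> Y L \<omega> / ennreal (c L)" using 3 by (intro divide_right_mono_ennreal) auto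
          finally show ?thesis .
        qed
        ultimately show ?thesis using 3
          by (simp add: indicator_def add_increasing2)
      next
        case 4
        then have "\<omega> \<notin> Q L" by (simp add: QSuc)
        with 4 show ?thesis by (simp add: indicator_def add_divide_distrib_ennreal cg)
      qed
    qed
    also have "\<dots> = \<Phi> L + ennreal (g L / c L)"
      unfolding \<Phi>_def by (subst nn_integral_add) (auto simp: emeasure_space_1)
    finally show ?thesis by (simp add: add_left_mono)
  qed
  have "\<Phi> L \<le> \<Phi> N + (\<Sum>n=N..<L. ennreal (g n / c n))"
    using \<open>N \<le> L\<close>
  proof (induction L rule: dec_induct)
    case (step L)
    have "\<Phi> (Suc L) \<le> \<Phi> L + ennreal (g L / c L)" using \<open>\<And>L. N \<le> L \<Longrightarrow> \<Phi> (Suc L) \<le> \<Phi> L + ennreal (g L / c L)\<close> step by auto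
    also have "\<dots> \<le> \<Phi> N + (\<Sum>n=N..<L. ennreal (g n / c n)) + ennreal (g L / c L)"
      using step by (intro add_right_mono)
    finally show ?case using step by (simp add: ac_simps)
  qed simp
  \<comment> \<open>The range \<open>{N..<N}\<close> is empty, so \<open>Q N\<close> is empty and
    only the scaled moment remains.\<close>
  moreover have "\<Phi> N = (\<integral>\<^sup>+\<omega>. indicator A \<omega> * Y N \<omega> \<partial>M) / ennreal (c N)"
    unfolding \<Phi>_def by (subst nn_integral_divide[symmetric]) (auto simp: Q_def ennreal_times_divide)
  moreover have "emeasure M (Q L) \<le> \<Phi> L"
    unfolding \<Phi>_def nn_integral_indicator[OF QM, symmetric] by (intro nn_integral_mono) simp
  ultimately show ?thesis by (simp add: Q_def)
qed

text \<open>Almost sure form of the maximal inequality. On each event where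
  \<open>Y n\<^sub>0\<close> is at most \<open>K\<close>, the probability of exceeding the barrier
  at some time from \<open>N\<close> on vanishes as \<open>N\<close> grows, so exceeding it
  infinitely often has probability zero there. Countably many such events cover the space.\<close>

lemma drift_eventually_below_barrier:
  fixes Y :: "nat \<Rightarrow> 'a \<Rightarrow> real" and g c :: "nat \<Rightarrow> real"
  assumes sub: "\<And>n. subalgebra M (\<F> n)" and mono: "\<And>m n. m \<le> n \<Longrightarrow> sets (\<F> m) \<subseteq> sets (\<F> n)"
    and Y: "\<And>n. Y n \<in> borel_measurable (\<F> n)"
    and drift: "\<And>n. n\<^sub>0 \<le> n \<Longrightarrow>
      AE \<omega> in M. nn_cond_exp M (\<F> n) (\<lambda>\<omega>. ennreal (Y (Suc n) \<omega>)) \<omega> \<le> ennreal (Y n \<omega>) + ennreal (g n)"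
    and g: "\<And>n. 0 \<le> g n"
    and c: "incseq c" "\<And>n. 0 < c n" "filterlim c at_top sequentially"
    and sm: "summable (\<lambda>n. g n / c n)"
  shows "AE \<omega> in M. \<exists>N. \<forall>n\<ge>N. Y n \<omega> \<le> c n"
proof -
  define A where "A K = {\<omega> \<in> space M. Y n\<^sub>0 \<omega> \<le> real K}" for K
  \<comment> \<open>The crossing is expressed in \<open>ennreal\<close> to match the maximal
    inequality. As \<open>c n\<close> is positive, it agrees with the real comparison although
    \<open>ennreal\<close> truncates negative values to 0.\<close>
  define Bad where "Bad K N = {\<omega> \<in> A K. \<exists>n\<ge>N. ennreal (c n) < ennreal (Y n \<omega>)}" for K N
  have spc: "space (\<F> n) = space M" for n using sub[of n] by (simp add: subalgebra_def)
  have [measurable]: "Y n \<in> borel_measurable M" for n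
    using measurable_from_subalg[OF sub Y] .
  have AF: "A K \<in> sets (\<F> n)" if "n\<^sub>0 \<le> n" for K n
  proof -
    have [measurable]: "Y n\<^sub>0 \<in> borel_measurable (\<F> n\<^sub>0)" by (rule Y)
    have "{\<omega> \<in> space (\<F> n\<^sub>0). Y n\<^sub>0 \<omega> \<le> real K} \<in> sets (\<F> n\<^sub>0)" by measurable
    then show ?thesis using mono[OF that] by (auto simp: A_def spc)
  qed
  have [measurable]: "A K \<in> sets M" for K unfolding A_def by measurable
  \<comment> \<open>Iterating the drift from \<open>n\<^sub>0\<close> adds only the increments with
    \<open>n\<^sub>0 \<le> k < n\<close>. Starting the sum at 0 adds nonnegative terms and produces
    the partial sums of Kronecker's lemma.\<close>
  have moment: "(\<integral>\<^sup>+\<omega>. indicator (A K) \<omega> * ennreal (Y n \<omega>) \<partial>M) \<le> ennreal (real K + (\<Sum>k<n. g k))"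
    if "n\<^sub>0 \<le> n" for K n
    using that
  proof (induction n rule: dec_induct)
    case base
    have "(\<integral>\<^sup>+\<omega>. indicator (A K) \<omega> * ennreal (Y n\<^sub>0 \<omega>) \<partial>M) \<le> (\<integral>\<^sup>+\<omega>. ennreal (real K) \<partial>M)"
      by (intro nn_integral_mono) (auto simp: A_def indicator_def intro!: ennreal_leI)
    also have "\<dots> \<le> ennreal (real K + (\<Sum>k<n\<^sub>0. g k))"
      using g by (auto simp: emeasure_space_1 sum_nonneg intro!: ennreal_leI)
    finally show ?case .
  next
    case (step n)
    have "(\<integral>\<^sup>+\<omega>. indicator (A K) \<omega> * ennreal (Y (Suc n) \<omega>) \<partial>M)
        \<le> (\<integral>\<^sup>+\<omega>. indicator (A K) \<omega> * (ennreal (Y n \<omega>) + ennreal (g n)) \<partial>M)"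
      using step by (intro nn_cond_exp_drift_integral[OF sub[of n]] AF drift) auto
    also have "\<dots> \<le> (\<integral>\<^sup>+\<omega>. indicator (A K) \<omega> * ennreal (Y n \<omega>) + ennreal (g n) \<partial>M)"
      by (intro nn_integral_mono) (auto split: split_indicator)
    also have "\<dots> = (\<integral>\<^sup>+\<omega>. indicator (A K) \<omega> * ennreal (Y n \<omega>) \<partial>M) + ennreal (g n)"
      by (subst nn_integral_add) (auto simp: emeasure_space_1)
    also have "\<dots> \<le> ennreal (real K + (\<Sum>k<n. g k)) + ennreal (g n)"
      using step by (intro add_right_mono)
    also have "\<dots> = ennreal (real K + (\<Sum>k<Suc n. g k))"
      using g by (subst ennreal_plus[symmetric]) (auto simp: sum_nonneg add.assoc)
    finally show ?case .
  qed
  \<comment> \<open>The three terms vanish for different reasons: divergence of \<open>c\<close>,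
    Kronecker's lemma, and convergence of the series whose tail is the last term.\<close>
  define T where "T K N = (real K / c N + (\<Sum>k<N. g k) / c N) + (\<Sum>k. g (k + N) / c (k + N))" for K N
  have T: "T K \<longlonglongrightarrow> 0" for K
  proof -
    have "(\<lambda>N. (real K / c N + (\<Sum>k<N. g k) / c N) + (\<Sum>k. g (k + N) / c (k + N))) \<longlonglongrightarrow> 0 + 0 + 0"
      by (intro tendsto_add kronecker_nonneg g c sm suminf_exist_split2[OF sm]
            real_tendsto_divide_at_top[OF tendsto_const c(3)])
    then show ?thesis by (simp add: T_def[abs_def])
  qed
  have bound: "emeasure M (Bad K N) \<le> ennreal (T K N)" if N: "n\<^sub>0 \<le> N" for K N
  proof -
    define Q where "Q L = {\<omega> \<in> A K. \<exists>n\<in>{N..<L}. ennreal (c n) < ennreal (Y n \<omega>)}" for L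
    have "Q L = {\<omega> \<in> space M. \<omega> \<in> A K \<and> (\<exists>n\<in>{N..<L}. ennreal (c n) < ennreal (Y n \<omega>))}" for L
      by (auto simp: Q_def A_def)
    then have [measurable]: "Q L \<in> sets M" for L by simp
    have incQ: "incseq Q" by (auto simp: incseq_def Q_def)
    \<comment> \<open>The maximal inequality has a finite horizon \<open>L\<close>; continuity from
      below along the increasing sets \<open>Q L\<close> removes it. Horizons below \<open>N\<close>
      are first raised to \<open>N\<close>.\<close>
    have "Bad K N = (\<Union>L. Q L)"
      unfolding Bad_def Q_def by (fastforce intro: lessI)
    then have "emeasure M (Bad K N) = (SUP L. emeasure M (Q L))"
      by (simp add: SUP_emeasure_incseq incQ image_subset_iff)
    also have "\<dots> \<le> ennreal (T K N)"
    proof (rule SUP_least)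
      fix L
      have "Q L \<subseteq> Q (max N L)" by (auto simp: Q_def)
      then have "emeasure M (Q L) \<le> emeasure M (Q (max N L))" by (intro emeasure_mono) auto
      also have "\<dots> \<le> (\<integral>\<^sup>+\<omega>. indicator (A K) \<omega> * ennreal (Y N \<omega>) \<partial>M) / ennreal (c N)
          + (\<Sum>n=N..<max N L. ennreal (g n / c n))"
        unfolding Q_def using N
        by (intro barrier_maximal_inequality[of \<F>] sub mono g c AF measurable_compose[OF Y measurable_ennreal] drift)
          auto
      also have "\<dots> \<le> ennreal (real K / c N + (\<Sum>k<N. g k) / c N) + ennreal (\<Sum>k. g (k + N) / c (k + N))"
      proof (rule add_mono)
        have "(\<integral>\<^sup>+\<omega>. indicator (A K) \<omega> * ennreal (Y N \<omega>) \<partial>M) / ennreal (c N)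
            \<le> ennreal (real K + (\<Sum>k<N. g k)) / ennreal (c N)"
          by (intro divide_right_mono_ennreal moment N)
        also have "\<dots> = ennreal (real K / c N + (\<Sum>k<N. g k) / c N)"
          using g c(2) by (subst divide_ennreal) (auto simp: sum_nonneg add_divide_distrib)
        finally show "(\<integral>\<^sup>+\<omega>. indicator (A K) \<omega> * ennreal (Y N \<omega>) \<partial>M) / ennreal (c N)
            \<le> ennreal (real K / c N + (\<Sum>k<N. g k) / c N)" .
        have gc: "0 \<le> g n / c n" for n using g[of n] c(2)[of n] by simp
        have "(\<Sum>n=N..<max N L. g n / c n) = (\<Sum>k<max N L - N. g (k + N) / c (k + N))"
          by (rule sum.reindex_bij_witness[of _ "\<lambda>k. k + N" "\<lambda>n. n - N"]) auto
        also have "\<dots> \<le> (\<Sum>k. g (k + N) / c (k + N))"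
          by (rule sum_le_suminf) (auto simp: gc summable_iff_shift[of "\<lambda>n. g n / c n"] sm)
        finally show "(\<Sum>n=N..<max N L. ennreal (g n / c n)) \<le> ennreal (\<Sum>k. g (k + N) / c (k + N))"
          using gc by (subst sum_ennreal) (auto intro: ennreal_leI)
      qed
      also have "\<dots> = ennreal (T K N)"
        unfolding T_def using g c(2)
        by (subst ennreal_plus)
          (auto simp: sum_nonneg less_imp_le intro!: suminf_nonneg add_nonneg_nonneg divide_nonneg_pos
             summable_iff_shift[of "\<lambda>n. g n / c n", THEN iffD2] sm)
      finally show "emeasure M (Q L) \<le> ennreal (T K N)" .
    qed
    finally show ?thesis .
  qed
  have null: "AE \<omega> in M. \<omega> \<notin> (\<Inter>N. Bad K N)" for K
  proof -
    have "Bad K N = {\<omega> \<in> space M. \<omega> \<in> A K \<and> (\<exists>n. N \<le> n \<and> ennreal (c n) < ennreal (Y n \<omega>))}" for N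
      by (auto simp: Bad_def A_def)
    then have BM[measurable]: "Bad K N \<in> sets M" for N by simp
    \<comment> \<open>The intersection lies in every \<open>Bad K N\<close>, so its measure is below
      all late \<open>T K N\<close> and hence below their limit 0.\<close>
    have "emeasure M (\<Inter>N. Bad K N) \<le> ennreal (T K N)" if "n\<^sub>0 \<le> N" for N
      by (rule order_trans[OF emeasure_mono bound[OF that]]) auto
    then have "emeasure M (\<Inter>N. Bad K N) \<le> ennreal 0"
      using T by (intro tendsto_lowerbound[OF tendsto_ennrealI[OF T[of K]]])
        (auto simp: eventually_sequentially)
    then have "(\<Inter>N. Bad K N) \<in> null_sets M" by (intro null_setsI) auto
    then show ?thesis by (rule AE_not_in)
  qed
  have "AE \<omega> in M. \<forall>K. \<omega> \<notin> (\<Inter>N. Bad K N)" using null by (simp only: AE_all_countable) simp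
  then show ?thesis
  proof (rule AE_mp, intro AE_I2 impI)
    fix \<omega> assume \<omega>: "\<omega> \<in> space M" and all: "\<forall>K. \<omega> \<notin> (\<Inter>N. Bad K N)"
    \<comment> \<open>Every point lies in some \<open>A K\<close>, so the countably many null sets
      settle all points.\<close>
    obtain K :: nat where "Y n\<^sub>0 \<omega> \<le> real K" using real_arch_simple by blast
    with \<omega> have "\<omega> \<in> A K" by (simp add: A_def)
    moreover obtain N where "\<omega> \<notin> Bad K N" using all by blast
    ultimately have "\<forall>n\<ge>N. ennreal (Y n \<omega>) \<le> ennreal (c n)" by (auto simp: Bad_def not_less)
    then show "\<exists>N. \<forall>n\<ge>N. Y n \<omega> \<le> c n"
      using c(2) by (auto simp: ennreal_le_iff less_imp_le)
  qed
qed

end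

section \<open>Noise filtration and adaptedness of the scheme\<close>

lemma noise_filtration_generator_subset:
  "(\<Union>k\<in>{1..n}. {U k -` A \<inter> space M | A. A \<in> sets borel}) \<subseteq> Pow (space M)"
  by auto

lemma sets_noise_filtration:
  "sets (noise_filtration M U n) =
    sigma_sets (space M) (\<Union>k\<in>{1..n}. {U k -` A \<inter> space M | A. A \<in> sets borel})"
  unfolding noise_filtration_def by (rule sets_measure_of[OF noise_filtration_generator_subset])

lemma space_noise_filtration: "space (noise_filtration M U n) = space M"
  unfolding noise_filtration_def by (rule space_measure_of[OF noise_filtration_generator_subset])

lemma subalgebra_noise_filtration:
  assumes "\<And>k. 1 \<le> k \<Longrightarrow> U k \<in> borel_measurable M"
  shows "subalgebra M (noise_filtration M U n)"
  unfolding subalgebra_def space_noise_filtration sets_noise_filtration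
  using assms by (intro conjI refl sets.sigma_sets_subset) (auto intro: measurable_sets)

lemma noise_filtration_mono:
  assumes "m \<le> n"
  shows "sets (noise_filtration M U m) \<subseteq> sets (noise_filtration M U n)"
  unfolding sets_noise_filtration using assms by (intro sigma_sets_subseteq UN_mono) auto

lemma measurable_noise_filtration:
  fixes U :: "nat \<Rightarrow> 'w \<Rightarrow> real ^ 'm"
  assumes "1 \<le> k" "k \<le> n"
  shows "U k \<in> borel_measurable (noise_filtration M U n)"
proof (rule measurableI)
  fix A assume "A \<in> sets (borel :: (real ^ 'm) measure)"
  then show "U k -` A \<inter> space (noise_filtration M U n) \<in> sets (noise_filtration M U n)"
    unfolding sets_noise_filtration space_noise_filtration
    using assms by (intro sigma_sets.Basic UN_I[of k]) auto
qed simp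

lemma borel_measurable_noise_filtration_mono:
  assumes "m \<le> n" "Y \<in> measurable (noise_filtration M U m) N"
  shows "Y \<in> measurable (noise_filtration M U n) N"
  using assms(2) noise_filtration_mono[OF assms(1), of M U]
  by (simp add: measurable_def space_noise_filtration subset_iff)

text \<open>The step sequence is predictable: the step of index \<open>Suc n\<close> involves only
  \<open>chi n\<close>, so it is known at time \<open>n\<close>, before
  \<open>U (Suc n)\<close>.\<close>

lemma measurable_adaptive_step:
  assumes "\<And>n. chi n \<in> borel_measurable (noise_filtration M U n)"
  shows "adaptive_step \<gamma> chi (Suc n) \<in> borel_measurable (noise_filtration M U n)"
proof -
  note [measurable] = assms[of n]
  show ?thesis by (simp add: adaptive_step.simps(2)[abs_def] fun_eq_iff cong: measurable_cong)
qed

lemma measurable_euler_scheme: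
  fixes b :: "real ^ 'd \<Rightarrow> real ^ 'd" and \<sigma> :: "real ^ 'd \<Rightarrow> real ^ 'm ^ 'd"
  assumes b: "b \<in> borel_measurable borel" and \<sigma>: "\<sigma> \<in> borel_measurable borel"
    and h: "\<And>n. h (Suc n) \<in> borel_measurable (noise_filtration M U n)"
  shows "euler_scheme b \<sigma> h U x\<^sub>0 n \<in> borel_measurable (noise_filtration M U n)"
proof (induction n)
  case 0
  then show ?case by (simp add: euler_scheme.simps(1)[abs_def])
next
  case (Suc n)
  let ?X = "euler_scheme b \<sigma> h U x\<^sub>0"
  have X[measurable]: "?X n \<in> borel_measurable (noise_filtration M U (Suc n))"
    and hn[measurable]: "h (Suc n) \<in> borel_measurable (noise_filtration M U (Suc n))"
    by (rule borel_measurable_noise_filtration_mono[OF le_SucI[OF order_refl]], rule Suc h)+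
  have [measurable]: "U (Suc n) \<in> borel_measurable (noise_filtration M U (Suc n))"
    by (rule measurable_noise_filtration) auto
  note [measurable] = b \<sigma>
  \<comment> \<open>The matrix-vector product is jointly continuous, so its composition with the two
    measurable factors is measurable.\<close>
  have cont: "continuous_on UNIV (\<lambda>p :: (real ^ 'm ^ 'd) \<times> (real ^ 'm). fst p *v snd p)"
    unfolding matrix_vector_mult_def by (intro continuous_intros)
  have [measurable]: "(\<lambda>\<omega>. \<sigma> (?X n \<omega>) *v U (Suc n) \<omega>) \<in> borel_measurable (noise_filtration M U (Suc n))"
    by (rule borel_measurable_continuous_Pair[OF _ _ cont]) measurable
  show ?case by (simp add: euler_scheme.simps(2)[abs_def])
qed

section \<open>Drift bound from the increment rate, and barrier from the inverse of
  \<open>f\<close>\<close>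

lemma drift_of_increment_rate:
  fixes e :: ennreal
  assumes "(enn2ereal e - ereal w) / ereal h \<le> ereal (- \<alpha> * w + \<beta>)"
    and "0 \<le> w" "0 < h" "h \<le> \<gamma>" "0 < \<alpha>" "0 < \<beta>"
  shows "e \<le> ennreal w + ennreal (\<beta> * \<gamma>)"
proof (cases e)
  case (real r)
  then have "(r - w) / h \<le> - \<alpha> * w + \<beta>" using assms by simp
  then have "r - w \<le> (- \<alpha> * w + \<beta>) * h" using assms by (simp add: pos_divide_le_eq)
  \<comment> \<open>The nonpositive term \<open>- \<alpha> * w\<close> is dropped; replacing
    \<open>h\<close> by \<open>\<gamma>\<close> next makes the bound deterministic.\<close>
  also have "\<dots> \<le> \<beta> * h" using assms by (intro mult_right_mono) auto
  also have "\<dots> \<le> \<beta> * \<gamma>" using assms by (intro mult_left_mono) auto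
  finally have "r \<le> w + \<beta> * \<gamma>" by simp
  moreover have "0 \<le> \<beta> * \<gamma>" using assms by simp
  ultimately show ?thesis using real assms by (simp add: ennreal_plus[symmetric] ennreal_leI del: ennreal_plus)
next
  \<comment> \<open>An infinite conditional expectation is excluded: with \<open>w\<close> finite
    and \<open>h\<close> positive and finite, the quotient would be \<infinity>, above its real
    bound.\<close>
  case top
  then show ?thesis using assms(1,3) by simp
qed

text \<open>Since \<open>f\<close> decreases, nonincreasing steps have nondecreasing preimages.
  These diverge because, for \<open>Z > 1\<close>, the value \<open>f Z\<close> is positive; the
  steps eventually fall below it, which puts their preimages above \<open>Z\<close>.\<close>

lemma
  fixes f :: "real \<Rightarrow> real" and \<gamma> :: "nat \<Rightarrow> real"
  assumes anti: "strict_antimono_on {1<..} f" and bij: "bij_betw f {1<..} {0<..}"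
    and \<gamma>: "decseq \<gamma>" "\<And>n. 0 < \<gamma> n" "\<gamma> \<longlonglongrightarrow> 0"
  shows inverse_barrier_gt_1: "1 < inv_into {1<..} f (\<gamma> n)"
    and inverse_barrier_eq: "f (inv_into {1<..} f (\<gamma> n)) = \<gamma> n"
    and incseq_inverse_barrier: "incseq (\<lambda>n. inv_into {1<..} f (\<gamma> n))"
    and inverse_barrier_at_top: "filterlim (\<lambda>n. inv_into {1<..} f (\<gamma> n)) at_top sequentially"
proof -
  define c where "c n = inv_into {1<..} f (\<gamma> n)" for n
  have im: "\<gamma> n \<in> f ` {1<..}" for n using bij \<gamma>(2)[of n] by (auto simp: bij_betw_def)
  have c1: "1 < c n" for n using inv_into_into[OF im] by (simp add: c_def)
  have fc: "f (c n) = \<gamma> n" for n using f_inv_into_f[OF im] by (simp add: c_def)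
  have less: "x < c n" if "1 < x" "\<gamma> n < f x" for x n
    using monotone_onD[OF anti, of "c n" x] that c1[of n] fc[of n] by (cases "c n" x rule: linorder_cases) auto
  show "1 < inv_into {1<..} f (\<gamma> n)" "f (inv_into {1<..} f (\<gamma> n)) = \<gamma> n"
    using c1 fc by (auto simp: c_def)
  have "c n \<le> c (Suc n)" for n
    using monotone_onD[OF anti, of "c (Suc n)" "c n"] c1 fc decseq_SucD[OF \<gamma>(1), of n] by (force simp: not_le[symmetric])
  then show "incseq (\<lambda>n. inv_into {1<..} f (\<gamma> n))" by (auto simp: c_def intro: incseq_SucI)
  have "filterlim c at_top sequentially"
    unfolding filterlim_at_top_gt[where c = 1]
  proof (intro allI impI)
    fix Z :: real assume "1 < Z"
    then have "0 < f Z" using bij by (auto simp: bij_betw_def)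
    then have "\<forall>\<^sub>F n in sequentially. \<gamma> n < f Z" by (rule order_tendstoD(2)[OF \<gamma>(3)])
    then show "\<forall>\<^sub>F n in sequentially. Z \<le> c n"
      by eventually_elim (use less \<open>1 < Z\<close> in \<open>auto intro: less_imp_le\<close>)
  qed
  then show "filterlim (\<lambda>n. inv_into {1<..} f (\<gamma> n)) at_top sequentially" by (simp add: c_def[abs_def])
qed

text \<open>Staying below the barrier forces a large threshold: for \<open>1 < w < c\<close> because
  \<open>f\<close> decreases, at \<open>w = 1\<close> because the value is \<infinity>.\<close>

lemma infinite_at_one_ge:
  assumes anti: "strict_antimono_on {1<..} f" and "1 \<le> w" "w \<le> c" "1 < c"
  shows "ennreal (f c) \<le> infinite_at_one f w"
proof (cases "w = c \<or> w = 1")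
  case True
  then show ?thesis using assms by (auto simp: infinite_at_one_def)
next
  case False
  then have "f c < f w" using assms by (intro monotone_onD[OF anti]) auto
  then show ?thesis using False by (simp add: infinite_at_one_def ennreal_leI)
qed

section \<open>Stabilisation of the adaptive steps\<close>

theorem proposition5:
  fixes M :: "'w measure"
    and U :: "nat \<Rightarrow> 'w \<Rightarrow> real ^ 'm"
    and b :: "real ^ 'd \<Rightarrow> real ^ 'd"
    and \<sigma> :: "real ^ 'd \<Rightarrow> real ^ 'm ^ 'd"
    and \<gamma> :: "nat \<Rightarrow> real"
    and chi :: "nat \<Rightarrow> 'w \<Rightarrow> ennreal"
    and x\<^sub>0 :: "real ^ 'd"
    and V W :: "real ^ 'd \<Rightarrow> real"
    and f :: "real \<Rightarrow> real"
  defines "F \<equiv> noise_filtration M U"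
    and "h \<equiv> adaptive_step \<gamma> chi"
    and "X \<equiv> euler_scheme b \<sigma> (adaptive_step \<gamma> chi) U x\<^sub>0"
  assumes "prob_space M"
    and "subgaussian_noise M U"
    and "local_lipschitz UNIV UNIV (\<lambda>_::real. b)"
    and "local_lipschitz UNIV UNIV (\<lambda>_::real. \<sigma>)"
    and "decseq \<gamma>" "\<And>n. 0 < \<gamma> n" "\<gamma> \<longlonglongrightarrow> 0" "\<not> summable \<gamma>"
    and "\<And>n. chi n \<in> borel_measurable (F n)"
    and "\<And>n. AE \<omega> in M. 0 < chi n \<omega>"
    and "lyapunov b \<sigma> V"
    and "strict_antimono_on {1<..} f" "continuous_on {1<..} f" "bij_betw f {1<..} {0<..}"
    and "(f \<longlongrightarrow> 0) at_top" "filterlim f at_top (at_right 1)"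
    and "W \<in> borel_measurable borel" "\<And>x. 1 \<le> W x"
    and "\<exists>\<alpha>>0. \<exists>\<beta>>0. \<exists>n\<^sub>0. \<forall>n\<ge>n\<^sub>0.
           AE \<omega> in M. cond_increment_rate M F h X W n \<omega> \<le> ereal (- \<alpha> * W (X n \<omega>) + \<beta>)"
    and "\<And>n. AE \<omega> in M. infinite_at_one f (W (X n \<omega>)) \<le> chi n \<omega>"
    and "summable (\<lambda>n. \<gamma> (Suc n) / inv_into {1<..} f (\<gamma> (Suc n)))"
  shows "\<exists>n\<^sub>1 :: 'w \<Rightarrow> enat.
           n\<^sub>1 \<in> M \<rightarrow>\<^sub>M count_space UNIV \<and>
           (AE \<omega> in M. n\<^sub>1 \<omega> \<noteq> \<infinity>) \<and>
           (AE \<omega> in M. \<forall>n. n\<^sub>1 \<omega> \<le> enat n \<longrightarrow> h n \<omega> = \<gamma> n)"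
proof -
  interpret prob_space M by fact
  have UM: "U k \<in> borel_measurable M" if "1 \<le> k" for k
    using \<open>subgaussian_noise M U\<close> that by (auto simp: subgaussian_noise_def indep_vars_def)
  have sub: "subalgebra M (F n)" for n
    unfolding F_def by (rule subalgebra_noise_filtration[OF UM])
  have chiF: "chi n \<in> borel_measurable (noise_filtration M U n)" for n
    using \<open>\<And>n. chi n \<in> borel_measurable (F n)\<close> by (simp add: F_def)
  have hF: "h (Suc n) \<in> borel_measurable (F n)" for n
    unfolding h_def F_def by (rule measurable_adaptive_step[OF chiF])
  have hM[measurable]: "h n \<in> borel_measurable M" for n
  proof (cases n)
    case 0
    then show ?thesis by (simp add: h_def adaptive_step.simps(1)[abs_def])
  next
    case (Suc n)
    then show ?thesis using measurable_from_subalg[OF sub hF] by simp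
  qed
  \<comment> \<open>The local Lipschitz property gives continuity, hence Borel measurability of
    \<open>b\<close> and \<open>\<sigma>\<close>, which makes \<open>X\<close> adapted.\<close>
  have "continuous_on UNIV b" "continuous_on UNIV \<sigma>"
    using local_lipschitz_continuous_on[OF \<open>local_lipschitz UNIV UNIV (\<lambda>_::real. b)\<close>]
      local_lipschitz_continuous_on[OF \<open>local_lipschitz UNIV UNIV (\<lambda>_::real. \<sigma>)\<close>] by blast+
  then have XF: "X n \<in> borel_measurable (F n)" for n
    unfolding X_def F_def
    by (intro measurable_euler_scheme measurable_adaptive_step[OF chiF] borel_measurable_continuous_onI)
  obtain \<alpha> \<beta> n\<^sub>0 where "0 < \<alpha>" "0 < \<beta>"
    and rate: "\<And>n. n\<^sub>0 \<le> n \<Longrightarrow> AE \<omega> in M. cond_increment_rate M F h X W n \<omega> \<le> ereal (- \<alpha> * W (X n \<omega>) + \<beta>)"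
    using \<open>\<exists>\<alpha>>0. \<exists>\<beta>>0. \<exists>n\<^sub>0. \<forall>n\<ge>n\<^sub>0.
      AE \<omega> in M. cond_increment_rate M F h X W n \<omega> \<le> ereal (- \<alpha> * W (X n \<omega>) + \<beta>)\<close> by blast
  have \<gamma>: "decseq (\<lambda>n. \<gamma> (Suc n))" "\<And>n. 0 < \<gamma> (Suc n)" "(\<lambda>n. \<gamma> (Suc n)) \<longlonglongrightarrow> 0"
    using \<open>decseq \<gamma>\<close> \<open>\<And>n. 0 < \<gamma> n\<close> LIMSEQ_Suc[OF \<open>\<gamma> \<longlonglongrightarrow> 0\<close>] by (simp_all add: decseq_def)
  have anti: "strict_antimono_on {1<..} f" and bij: "bij_betw f {1<..} {0<..}" by fact+
  \<comment> \<open>The index is shifted: \<open>X n\<close> governs the step \<open>Suc n\<close>,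
    so the barrier for \<open>W (X n)\<close> is the preimage of
    \<open>\<gamma> (Suc n)\<close>.\<close>
  define c where "c n = inv_into {1<..} f (\<gamma> (Suc n))" for n
  note barrier = inverse_barrier_gt_1[OF anti bij \<gamma>, folded c_def] inverse_barrier_eq[OF anti bij \<gamma>, folded c_def]
    incseq_inverse_barrier[OF anti bij \<gamma>, folded c_def] inverse_barrier_at_top[OF anti bij \<gamma>, folded c_def]
  have W1: "\<And>x. 1 \<le> W x" by fact
  have below: "AE \<omega> in M. \<exists>N. \<forall>n\<ge>N. W (X n \<omega>) \<le> c n"
  proof (rule drift_eventually_below_barrier[where \<F> = F and n\<^sub>0 = n\<^sub>0 and g = "\<lambda>n. \<beta> * \<gamma> (Suc n)"])
    show "sets (F m) \<subseteq> sets (F n)" if "m \<le> n" for m n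
      unfolding F_def by (rule noise_filtration_mono[OF that])
    show "(\<lambda>\<omega>. W (X n \<omega>)) \<in> borel_measurable (F n)" for n
      by (rule measurable_compose[OF XF]) fact
    show "AE \<omega> in M. nn_cond_exp M (F n) (\<lambda>\<omega>. ennreal (W (X (Suc n) \<omega>))) \<omega>
        \<le> ennreal (W (X n \<omega>)) + ennreal (\<beta> * \<gamma> (Suc n))" if n: "n\<^sub>0 \<le> n" for n
      using rate[OF n] \<open>\<And>n. AE \<omega> in M. 0 < chi n \<omega>\<close>[of n]
    proof eventually_elim
      case (elim \<omega>)
      \<comment> \<open>The rate is a quotient by \<open>h (Suc n)\<close>, so this step must be
        strictly positive. As \<open>enn2real\<close> sends \<infinity> to 0, finiteness of the
        minimum matters as well as positivity of \<open>chi n\<close>.\<close>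
      let ?m = "min (ennreal (\<gamma> (Suc n))) (chi n \<omega>)"
      have m: "0 < ?m" "?m \<le> ennreal (\<gamma> (Suc n))" using elim \<gamma>(2)[of n] by auto
      then have "?m < top" using ennreal_less_top le_less_trans by blast
      then have "0 < h (Suc n) \<omega>" using m by (simp add: h_def enn2real_positive_iff)
      moreover have "h (Suc n) \<omega> \<le> \<gamma> (Suc n)"
        using m(2) \<gamma>(2)[of n] by (simp add: h_def enn2real_leI)
      moreover have "0 \<le> W (X n \<omega>)" using W1[of "X n \<omega>"] by simp
      ultimately show ?case
        using elim(1) \<open>0 < \<alpha>\<close> \<open>0 < \<beta>\<close> unfolding cond_increment_rate_def by (intro drift_of_increment_rate)
    qed
    show "summable (\<lambda>n. \<beta> * \<gamma> (Suc n) / c n)"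
      using summable_mult[OF \<open>summable (\<lambda>n. \<gamma> (Suc n) / inv_into {1<..} f (\<gamma> (Suc n)))\<close>, of \<beta>]
      by (simp add: c_def)
    show "0 < c n" for n using barrier(1)[of n] by simp
    show "0 \<le> \<beta> * \<gamma> (Suc n)" for n using \<gamma>(2)[of n] \<open>0 < \<beta>\<close> by simp
  qed (intro sub barrier)+
  have "AE \<omega> in M. \<forall>n. infinite_at_one f (W (X n \<omega>)) \<le> chi n \<omega>"
    unfolding AE_all_countable using \<open>\<And>n. AE \<omega> in M. infinite_at_one f (W (X n \<omega>)) \<le> chi n \<omega>\<close> by blast
  with below have stable: "AE \<omega> in M. \<exists>N. \<forall>n\<ge>N. h n \<omega> = \<gamma> n"
  proof eventually_elim
    case (elim \<omega>)
    then obtain N where N: "\<And>n. N \<le> n \<Longrightarrow> W (X n \<omega>) \<le> c n" by blast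
    have "h (Suc n) \<omega> = \<gamma> (Suc n)" if "N \<le> n" for n
    proof -
      \<comment> \<open>Below the barrier the threshold is at least \<open>f (c n)\<close>, which is
        \<open>\<gamma> (Suc n)\<close>, so the minimum defining the step equals
        \<open>\<gamma> (Suc n)\<close>.\<close>
      have "ennreal (\<gamma> (Suc n)) \<le> infinite_at_one f (W (X n \<omega>))"
        using infinite_at_one_ge[OF anti W1 N[OF that] barrier(1)] barrier(2)[of n] by simp
      then have "ennreal (\<gamma> (Suc n)) \<le> chi n \<omega>" using elim(2) order_trans by blast
      then show ?thesis using \<gamma>(2)[of n] by (simp add: h_def min_absorb1 less_imp_le)
    qed
    \<comment> \<open>A bound on \<open>W (X n)\<close> from \<open>N\<close> on controls the steps
      from \<open>Suc N\<close> on.\<close>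
    then have "\<forall>n\<ge>Suc N. h n \<omega> = \<gamma> n" by (metis Suc_le_D Suc_le_mono)
    then show ?case by blast
  qed
  define P where "P N \<omega> \<longleftrightarrow> (\<forall>n\<ge>N. h n \<omega> = \<gamma> n)" for N \<omega>
  have [measurable]: "Measurable.pred M (P N)" for N unfolding P_def[abs_def] by measurable
  \<comment> \<open>The first index from which the steps agree, with \<infinity> on the null set
    where there is none. As \<open>n\<^sub>1 \<omega> \<le> enat n\<close> excludes \<infinity>, the
    final implication holds at every point.\<close>
  define n\<^sub>1 where "n\<^sub>1 \<omega> = (if \<exists>N. P N \<omega> then enat (LEAST N. P N \<omega>) else \<infinity>)" for \<omega>
  have "n\<^sub>1 \<in> M \<rightarrow>\<^sub>M count_space UNIV" unfolding n\<^sub>1_def[abs_def] by measurable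
  moreover have "AE \<omega> in M. n\<^sub>1 \<omega> \<noteq> \<infinity>" using stable by eventually_elim (auto simp: n\<^sub>1_def P_def)
  moreover have "h n \<omega> = \<gamma> n" if le: "n\<^sub>1 \<omega> \<le> enat n" for n \<omega>
  proof -
    have ex: "\<exists>N. P N \<omega>" using le by (auto simp: n\<^sub>1_def split: if_splits)
    then have "P (LEAST N. P N \<omega>) \<omega>" by (rule LeastI_ex)
    moreover have "(LEAST N. P N \<omega>) \<le> n" using le ex by (simp add: n\<^sub>1_def)
    moreover have "h n \<omega> = \<gamma> n" if "P N \<omega>" "N \<le> n" for N using that by (simp add: P_def)
    ultimately show ?thesis by blast
  qed
  ultimately show ?thesis by (intro exI[of _ n\<^sub>1] conjI) simp_all
qed

end
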